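(* Let $\mathcal P:\mathcal U^o\to W^*$, and assume that $$-\infty<\lambda^*_{\mathcal A+\mathcal P}:=\sup_{u\in\mathcal U^o}\inf_{v\in\mathcal S\setminus\{0\}}\mathcal R_{\mathcal A+\mathcal P}(u,v)<+\infty.$$ If $u^*_{\mathcal A}\in\mathcal U^o$ satisfies $$\lambda^*_{\mathcal A}=\inf_{v\in\mathcal S\setminus\{0\}}\mathcal R_{\mathcal A}(u^*_{\mathcal A},v),$$ then $$\lambda^*_{\mathcal A+\mathcal P}\ge\lambda^*_{\mathcal A}+\inf_{v\in\mathcal S\setminus\{0\}}\frac{\langle\mathcal P(u^*_{\mathcal A}),v\rangle}{\langle\mathcal G(u^*_{\mathcal A}),v\rangle}.$$
   Context: $W$ is a reflexive Banach space with dual $W^*$ and duality pairing $\langle\cdot,\cdot\rangle$; $\mathcal C^0$ is an ordered Banach function space ($W$ and $\mathcal C^0$ are subspaces of a common vector space). $\mathcal S^o\subset W\cap\mathcal C^0$ is a convex cone, $\mathcal S:=\overline{\mathcal S^o}^{\,\mathcal C^0}\cap W$, $\overline{\operatorname{span}\mathcal S^o}^{\,W}=W$, and $\mathcal U^o\subset\mathcal S^o$ is a fixed subclass. $\mathcal A,\mathcal G:W\to W^*$ are maps with $\langle\mathcal G(u),v\rangle>0$ for every $(u,v)\in\mathcal S^o\times(\mathcal S\setminus\{0\})$. For an operator $\mathcal B$ (here $\mathcal B=\mathcal A$ or $\mathcal B=\mathcal A+\mathcal P$) defined on $\mathcal U^o$ with values in $W^*$, $$\mathcal R_{\mathcal B}(u,v):=\frac{\langle\mathcal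 B(u),v\rangle}{\langle\mathcal G(u),v\rangle},\qquad \lambda^*_{\mathcal B}:=\sup_{u\in\mathcal U^o}\inf_{v\in\mathcal S\setminus\{0\}}\mathcal R_{\mathcal B}(u,v).$$ *)

theory Defs
  imports "HOL-Analysis.Analysis"
begin

definition reflexive_banach :: "'w::banach itself \<Rightarrow> bool" where
  "reflexive_banach _ \<longleftrightarrow>
     (\<forall>\<Phi> :: ('w \<Rightarrow>\<^sub>L real) \<Rightarrow>\<^sub>L real. \<exists>w::'w. \<forall>f. blinfun_apply \<Phi> f = blinfun_apply f w)"

(* The elements of 'c are real functions on 'x (via the realization ev), identified along the
   filter F and ordered pointwise along F.  F = top gives functions with the pointwise order
   (e.g. continuous functions), F = ae_filter M gives classes modulo M-null sets.  Since the
   order of 'c is antisymmetric, ev is injective modulo F. *)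
definition ordered_banach_function_space ::
    "'x filter \<Rightarrow> ('c::{banach, ordered_real_vector} \<Rightarrow> 'x \<Rightarrow> real) \<Rightarrow> bool" where
  "ordered_banach_function_space F ev \<longleftrightarrow>
     (\<forall>f g. \<forall>\<^sub>F x in F. ev (f + g) x = ev f x + ev g x) \<and>
     (\<forall>c f. \<forall>\<^sub>F x in F. ev (c *\<^sub>R f) x = c * ev f x) \<and>
     (\<forall>f g. f \<le> g \<longleftrightarrow> (\<forall>\<^sub>F x in F. ev f x \<le> ev g x)) \<and>
     closed {f::'c. 0 \<le> f}"

(* Unlike the library's convex_cone, the vertex 0 need not belong to the cone: cones such as
   the strictly positive functions are admitted. *)
definition convex_cone_pos :: "'a::real_vector set \<Rightarrow> bool" where
  "convex_cone_pos K \<longleftrightarrow> convex K \<and> (\<forall>x\<in>K. \<forall>c>0. c *\<^sub>R x \<in> K)"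

(* The spaces W = 'w and C^0 = 'c are subspaces of the common vector space 'v via the injective
   linear maps jW and jC.  So is given as a subset of 'w; its closure is taken in the topology
   of 'c, and the result is intersected with W, again as a subset of 'w. *)
definition closure_in_W ::
    "('w \<Rightarrow> 'v) \<Rightarrow> ('c::topological_space \<Rightarrow> 'v) \<Rightarrow> 'w set \<Rightarrow> 'w set" where
  "closure_in_W jW jC So = {w. jW w \<in> jC ` closure (jC -` (jW ` So))}"

definition rayleigh ::
    "('w::real_normed_vector \<Rightarrow> ('w \<Rightarrow>\<^sub>L real)) \<Rightarrow> ('w \<Rightarrow> ('w \<Rightarrow>\<^sub>L real)) \<Rightarrow> 'w \<Rightarrow> 'w \<Rightarrow> real" where
  "rayleigh G B u v = blinfun_apply (B u) v / blinfun_apply (G u) v"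

(* Valued in the extended reals, since neither the infima nor the supremum need be finite.
   Only the values of B on Uo are used. *)
definition lambda_star ::
    "('w::real_normed_vector \<Rightarrow> ('w \<Rightarrow>\<^sub>L real)) \<Rightarrow> 'w set \<Rightarrow> 'w set \<Rightarrow>
     ('w \<Rightarrow> ('w \<Rightarrow>\<^sub>L real)) \<Rightarrow> ereal" where
  "lambda_star G Uo S B = (SUP u\<in>Uo. INF v\<in>S - {0}. ereal (rayleigh G B u v))"

end

theory Submission
  imports Defs
begin

text \<open>For fixed \<open>u\<close> the quotient \<open>rayleigh\<close> is additive in the
  operator, because numerators add over the common denominator \<open>G u v\<close>. An infimum of a
  sum dominates the sum of the infima, so at \<open>uA\<close> the infimum for \<open>A + P\<close>
  is at least the infimum for \<open>A\<close>, which is \<open>lambda_star G Uo S A\<close> by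
  optimality of \<open>uA\<close>, plus the infimum of the \<open>P\<close> quotient. Since
  \<open>uA\<close> is an admissible trial point for the supremum, the bound passes to
  \<open>A + P\<close>.\<close>

theorem corollary3p3:
  fixes jW :: "'w::banach \<Rightarrow> 'v::real_vector"
    and jC :: "'c::{banach, ordered_real_vector} \<Rightarrow> 'v"
    and F :: "'x filter" and ev :: "'c \<Rightarrow> 'x \<Rightarrow> real"
    and So S Uo :: "'w set"
    and A G P :: "'w \<Rightarrow> ('w \<Rightarrow>\<^sub>L real)"
    and uA :: 'w
  assumes "reflexive_banach TYPE('w)"
    and "ordered_banach_function_space F ev"
    and "linear jW" "inj jW" "linear jC" "inj jC"
    and "jW ` So \<subseteq> range jC"
    and "convex_cone_pos So"
    and S_def: "S = closure_in_W jW jC So"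
    and "closure (span So) = UNIV"
    and "Uo \<subseteq> So"
    and "\<And>u v. u \<in> So \<Longrightarrow> v \<in> S - {0} \<Longrightarrow> blinfun_apply (G u) v > 0"
    and "- \<infinity> < lambda_star G Uo S (\<lambda>u. A u + P u)"
    and "lambda_star G Uo S (\<lambda>u. A u + P u) < \<infinity>"
    and "uA \<in> Uo"
    and "lambda_star G Uo S A = (INF v\<in>S - {0}. ereal (rayleigh G A uA v))"
  shows "lambda_star G Uo S (\<lambda>u. A u + P u) \<ge>
           lambda_star G Uo S A +
           (INF v\<in>S - {0}. ereal (blinfun_apply (P uA) v / blinfun_apply (G uA) v))"
proof -
  have "lambda_star G Uo S A +
      (INF v\<in>S - {0}. ereal (blinfun_apply (P uA) v / blinfun_apply (G uA) v))
      \<le> (INF v\<in>S - {0}. ereal (rayleigh G (\<lambda>u. A u + P u) uA v))"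
  proof (rule INF_greatest)
    fix v assume "v \<in> S - {0}"
    \<comment> \<open>Both infima are compared with their values at the same \<open>v\<close>.
      Addition on \<open>ereal\<close> is monotone in both arguments, so an infimum equal to
      -\<infinity> causes no trouble.\<close>
    then have "(INF v\<in>S - {0}. ereal (rayleigh G A uA v)) +
        (INF v\<in>S - {0}. ereal (blinfun_apply (P uA) v / blinfun_apply (G uA) v))
        \<le> ereal (rayleigh G A uA v) + ereal (blinfun_apply (P uA) v / blinfun_apply (G uA) v)"
      by (intro add_mono INF_lower)
    then show "lambda_star G Uo S A +
        (INF v\<in>S - {0}. ereal (blinfun_apply (P uA) v / blinfun_apply (G uA) v))
        \<le> ereal (rayleigh G (\<lambda>u. A u + P u) uA v)"
      \<comment> \<open>Optimality of \<open>uA\<close> enters here: it replaces the sup-inf value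
        for \<open>A\<close> by the infimum at \<open>uA\<close>.\<close>
      unfolding assms(16) by (simp add: rayleigh_def blinfun.add_left add_divide_distrib)
  qed
  \<comment> \<open>\<open>uA\<close> need not be optimal for \<open>A + P\<close>, hence only an
    inequality.\<close>
  also have "\<dots> \<le> lambda_star G Uo S (\<lambda>u. A u + P u)"
    unfolding lambda_star_def using \<open>uA \<in> Uo\<close> by (rule SUP_upper)
  finally show ?thesis .
qed

end
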